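(* Let $(\mathcal S,\mathcal A,\mathcal T,\gamma,\lambda)$ be an entropy-regularized infinite-horizon discounted MDP environment with $\mathcal S,\mathcal A$ finite, $|\mathcal S|,|\mathcal A|\ge2$, $\gamma\in[0,1)$, $\lambda>0$, and let $\bar\pi:\mathcal S\to\mathcal P(\mathcal A)$ be the observed optimal policy, with $\bar\pi(a|s)>0$ for all $(s,a)$. Fix $a_0\in\mathcal A$ and assume the system $\lambda\,\Delta\log\bar\pi(a)=\gamma\,\Delta\mathbb T(a)\,\upsilon$ for all $a\in\mathcal A$ admits a solution $\upsilon\in\mathbb R^{|\mathcal S|}$. Then the IRL problem is identifiable (i.e. the true action-independent reward function $f:\mathcal S\to\mathbb R$ can be inferred up to a constant shift) if and only if, writing $\mathcal K(a)$ for the kernel of $\Delta\mathbb T(a)$, $$\{c\mathbf 1:c\in\mathbb R\}=\bigcap_{a\in\mathcal A\setminus\{a_0\}}\mathcal K(a)=\bigcap_{a\in\mathcal A}\mathcal K(a),$$ where $\mathbf 1$ is the all-one vector in $\mathbb R^{|\mathcal S|}$. (Note that $\{c\mathbf 1:c\in\mathbb R\}\subset\mathcal K(a)$ for any $a\in\mathcal A\setminus\{a_0\}$, and $\Delta\mathbb T(a_0)=0$ implies $\mathcal K(a_0)=\mathbb R^{|\mathcal S|}$.)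
   Context: Write $\mathcal S=\{s_1,\dots,s_{|\mathcal S|}\}$. For $a\in\mathcal A$: $\log\bar\pi(a)\in\mathbb R^{|\mathcal S|}$ is the vector with entries $\log\bar\pi(a|s_i)$; $\mathbb T(a)$ is the $|\mathcal S|\times|\mathcal S|$ matrix with $[\mathbb T(a)]_{ij}=\mathcal T(s_j|s_i,a)$; $\Delta\log\bar\pi(a)=\log\bar\pi(a)-\log\bar\pi(a_0)$ and $\Delta\mathbb T(a)=\mathbb T(a)-\mathbb T(a_0)$. Entropy-regularized MDP with reward $f$: policies are maps $\pi:\mathcal S\to\mathcal P(\mathcal A)$ (probability distributions on $\mathcal A$); the optimal value is $V^*_\lambda(s)=\max_\pi\mathbb E^\pi_s\big[\sum_{t\ge0}\gamma^t(f(S_t,A_t)-\lambda\log\pi(A_t|S_t))\big]$, where $S_0=s$, $A_t\sim\pi(\cdot|S_t)$, $S_{t+1}\sim\mathcal T(\cdot|S_t,A_t)$. Standard facts: $V^*_\lambda(s)=\lambda\log\sum_a\exp(Q^*_\lambda(s,a)/\lambda)$ with $Q^*_\lambda(s,a)=f(s,a)+\gamma\sum_{s'}\mathcal T(s'|s,a)V^*_\lambda(s')$, and the entropy-regularized optimal policy is $\pi^*_\lambda(a|s)=\exp\big((Q^*_\lambda(s,a)-V^*_\lambda(s))/\lambda\big)$. The IRL problem is to find the rewards for which $\bar\pi$ is the entropy-regularized optimal policy. A reward is action-independent if $f(s,a)=f(s)$ does not depend on $a$.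
   Formalization: The discount is taken in (0,1) rather than [0,1): at γ=0 the uniform policy is optimal for every action-independent reward, so f is never identifiable, although the kernel condition can hold (two states and actions, next state equal to the action). *)

theory Defs
  imports "HOL-Probability.Probability"
begin

text \<open>
  States and actions are the elements of two finite types, \<open>T s a\<close> is the law of the next state,
  and a policy is a map \<open>\<pi> :: 's \<Rightarrow> 'a pmf\<close>.

  The law of the controlled process \<open>(S\<^sub>t, A\<^sub>t)\<close> started in \<open>s\<close> is obtained from the Ionescu-Tulcea
  theorem, whose \<open>n\<close>-th kernel is the conditional law of \<open>(S\<^sub>n, A\<^sub>n)\<close> given the trajectory before
  time \<open>n\<close>.
\<close>

definition mdp_kernel ::
    "('s \<Rightarrow> 'a \<Rightarrow> 's pmf) \<Rightarrow> ('s \<Rightarrow> 'a pmf) \<Rightarrow> 's \<Rightarrow> nat \<Rightarrow> (nat \<Rightarrow> 's \<times> 'a) \<Rightarrow> ('s \<times> 'a) measure"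
  where
  "mdp_kernel T \<pi> s n \<omega> = measure_pmf
     (bind_pmf (case n of 0 \<Rightarrow> return_pmf s | Suc m \<Rightarrow> T (fst (\<omega> m)) (snd (\<omega> m)))
       (\<lambda>s'. map_pmf (Pair s') (\<pi> s')))"

definition mdp_measure ::
    "('s \<Rightarrow> 'a \<Rightarrow> 's pmf) \<Rightarrow> ('s \<Rightarrow> 'a pmf) \<Rightarrow> 's \<Rightarrow> (nat \<Rightarrow> 's \<times> 'a) measure"
  where
  "mdp_measure T \<pi> s = projective_family.lim UNIV
     (Ionescu_Tulcea.CI (mdp_kernel T \<pi> s) (\<lambda>_. count_space UNIV)) (\<lambda>_. count_space UNIV)"

lemma Ionescu_Tulcea_mdp_kernel:
  fixes T :: "'s::finite \<Rightarrow> 'a::finite \<Rightarrow> 's pmf"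
  shows "Ionescu_Tulcea (mdp_kernel T \<pi> s) (\<lambda>_. count_space UNIV)"
proof (rule Ionescu_Tulcea.intro)
  let ?S = "subprob_algebra (count_space (UNIV :: ('s \<times> 'a) set))"
  let ?M = "\<lambda>_::nat. count_space (UNIV :: ('s \<times> 'a) set)"
  have pmf_in: "measure_pmf p \<in> space ?S" for p
    by (simp add: measure_pmf_in_subprob_algebra)
  show "mdp_kernel T \<pi> s n \<in> measurable (PiM {0..<n} ?M) ?S" for n
  proof (cases n)
    case 0
    then show ?thesis by (simp add: mdp_kernel_def[abs_def] pmf_in)
  next
    case (Suc m)
    have "(\<lambda>\<omega>. \<omega> m) \<in> measurable (PiM {0..<n} ?M) (count_space UNIV)"
      using Suc by (intro measurable_component_singleton) auto
    moreover have "(\<lambda>x. measure_pmf (bind_pmf (T (fst x) (snd x)) (\<lambda>s'. map_pmf (Pair s') (\<pi> s'))))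
        \<in> measurable (count_space UNIV) ?S"
      by (simp add: pmf_in)
    ultimately show ?thesis
      using Suc by (simp add: mdp_kernel_def[abs_def] measurable_compose)
  qed
  show "prob_space (mdp_kernel T \<pi> s n \<omega>)" if "\<omega> \<in> space (PiM {0..<n} ?M)" for n \<omega>
    by (simp add: mdp_kernel_def measure_pmf.prob_space_axioms)
qed

lemma prob_space_mdp_measure:
  fixes T :: "'s::finite \<Rightarrow> 'a::finite \<Rightarrow> 's pmf"
  shows "prob_space (mdp_measure T \<pi> s)"
proof -
  interpret Ionescu_Tulcea "mdp_kernel T \<pi> s" "\<lambda>_. count_space UNIV"
    by (rule Ionescu_Tulcea_mdp_kernel)
  have "prob_space (distr PF.lim (PiM {} (\<lambda>_. count_space UNIV)) (\<lambda>x. restrict x {}))"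
    unfolding distr_lim[OF finite.emptyI] by (rule PF.prob_space_P) auto
  then show ?thesis
    unfolding mdp_measure_def
    by (rule prob_space_distrD[rotated])
       (auto intro!: measurable_restrict simp: measurable_cong_sets[OF PF.sets_lim refl])
qed

text \<open>
  Since \<open>ln 0 = 0\<close>, actions of probability zero, which are almost surely never chosen, cause no
  difficulty for policies without full support.
\<close>

definition entropy_value ::
    "('s \<Rightarrow> 'a \<Rightarrow> 's pmf) \<Rightarrow> real \<Rightarrow> real \<Rightarrow> ('s \<Rightarrow> 'a \<Rightarrow> real) \<Rightarrow> ('s \<Rightarrow> 'a pmf) \<Rightarrow> 's \<Rightarrow> real"
  where
  "entropy_value T \<gamma> lam f \<pi> s =
     (\<integral>\<omega>. (\<Sum>t. \<gamma> ^ t * (f (fst (\<omega> t)) (snd (\<omega> t)) - lam * ln (pmf (\<pi> (fst (\<omega> t))) (snd (\<omega> t)))))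
        \<partial>mdp_measure T \<pi> s)"

definition entropy_optimal ::
    "('s \<Rightarrow> 'a \<Rightarrow> 's pmf) \<Rightarrow> real \<Rightarrow> real \<Rightarrow> ('s \<Rightarrow> 'a \<Rightarrow> real) \<Rightarrow> ('s \<Rightarrow> 'a pmf) \<Rightarrow> bool"
  where
  "entropy_optimal T \<gamma> lam f \<pi> \<longleftrightarrow>
     (\<forall>s \<pi>'. entropy_value T \<gamma> lam f \<pi>' s \<le> entropy_value T \<gamma> lam f \<pi> s)"

text \<open>
  The action-independent rewards that explain the observed policy. The problem is identifiable
  if any two of them differ by a constant.
\<close>

definition irl_rewards ::
    "('s \<Rightarrow> 'a \<Rightarrow> 's pmf) \<Rightarrow> real \<Rightarrow> real \<Rightarrow> ('s \<Rightarrow> 'a pmf) \<Rightarrow> ('s \<Rightarrow> real) set"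
  where
  "irl_rewards T \<gamma> lam \<pi> = {f. entropy_optimal T \<gamma> lam (\<lambda>s a. f s) \<pi>}"

definition irl_identifiable ::
    "('s \<Rightarrow> 'a \<Rightarrow> 's pmf) \<Rightarrow> real \<Rightarrow> real \<Rightarrow> ('s \<Rightarrow> 'a pmf) \<Rightarrow> bool"
  where
  "irl_identifiable T \<gamma> lam \<pi> \<longleftrightarrow>
     (\<forall>f \<in> irl_rewards T \<gamma> lam \<pi>. \<forall>g \<in> irl_rewards T \<gamma> lam \<pi>. \<exists>c. \<forall>s. g s = f s + c)"

definition log_policy :: "('s::finite \<Rightarrow> 'a pmf) \<Rightarrow> 'a \<Rightarrow> real ^ 's" where
  "log_policy \<pi> a = (\<chi> i. ln (pmf (\<pi> i) a))"

definition trans_matrix :: "('s::finite \<Rightarrow> 'a \<Rightarrow> 's pmf) \<Rightarrow> 'a \<Rightarrow> real ^ 's ^ 's" where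
  "trans_matrix T a = (\<chi> i j. pmf (T i a) j)"

definition Delta_log_policy :: "('s::finite \<Rightarrow> 'a pmf) \<Rightarrow> 'a \<Rightarrow> 'a \<Rightarrow> real ^ 's" where
  "Delta_log_policy \<pi> a0 a = log_policy \<pi> a - log_policy \<pi> a0"

definition Delta_trans :: "('s::finite \<Rightarrow> 'a \<Rightarrow> 's pmf) \<Rightarrow> 'a \<Rightarrow> 'a \<Rightarrow> real ^ 's ^ 's" where
  "Delta_trans T a0 a = trans_matrix T a - trans_matrix T a0"

definition Delta_kernel :: "('s::finite \<Rightarrow> 'a \<Rightarrow> 's pmf) \<Rightarrow> 'a \<Rightarrow> 'a \<Rightarrow> (real ^ 's) set" where
  "Delta_kernel T a0 a = {x. Delta_trans T a0 a *v x = 0}"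

end

theory Submission
  imports Defs
begin

text \<open>
  Let \<open>\<pi>\<close> be any policy and \<open>W\<close> any function on states. Telescoping \<open>\<gamma>\<^sup>t W(S\<^sub>t)\<close> shows that the value of
  \<open>\<pi>\<close> minus \<open>W\<close> is the expected discounted sum of one-step advantages relative to \<open>W\<close>. If \<open>W\<close> solves the
  soft Bellman equation together with a policy \<open>\<pi>*\<close> of full support, these advantages are
  \<open>- \<lambda> KL(\<pi> | \<pi>*)\<close>. So \<open>W\<close> is the optimal value, and \<open>\<pi>*\<close> is the only optimal policy.

  Hence the rewards that explain the observed policy \<open>\<pi>\<close> are
  \<open>f = v + \<lambda> log \<pi>(a\<^sub>0) - \<gamma> T(a\<^sub>0) v\<close>, where \<open>v\<close> ranges over the solutions of the linear system,
  an affine space with direction \<open>K = \<Inter>\<^sub>a K(a)\<close>. Moving \<open>v\<close> by \<open>x \<in> K\<close> moves \<open>f\<close> by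
  \<open>x - \<gamma> T(a\<^sub>0) x\<close>. Since \<open>\<gamma> < 1\<close>, this is constant exactly if \<open>x\<close> is.
\<close>

section \<open>Marginal laws of the controlled process\<close>

primrec state_action_pmf ::
    "('s \<Rightarrow> 'a \<Rightarrow> 's pmf) \<Rightarrow> ('s \<Rightarrow> 'a pmf) \<Rightarrow> 's \<Rightarrow> nat \<Rightarrow> ('s \<times> 'a) pmf" where
  "state_action_pmf T \<pi> s 0 = map_pmf (Pair s) (\<pi> s)"
| "state_action_pmf T \<pi> s (Suc n) = bind_pmf (state_action_pmf T \<pi> s n)
     (\<lambda>x. bind_pmf (T (fst x) (snd x)) (\<lambda>s'. map_pmf (Pair s') (\<pi> s')))"

lemma sets_mdp_measure:
  fixes T :: "'s::finite \<Rightarrow> 'a::finite \<Rightarrow> 's pmf"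
  shows "sets (mdp_measure T \<pi> s) = sets (PiM UNIV (\<lambda>_. count_space UNIV))"
proof -
  interpret Ionescu_Tulcea "mdp_kernel T \<pi> s" "\<lambda>_. count_space UNIV"
    by (rule Ionescu_Tulcea_mdp_kernel)
  show ?thesis
    unfolding mdp_measure_def by (rule PF.sets_lim)
qed

lemma measurable_mdp_coordinate [measurable]:
  fixes T :: "'s::finite \<Rightarrow> 'a::finite \<Rightarrow> 's pmf"
  shows "(\<lambda>\<omega>. \<omega> n) \<in> measurable (mdp_measure T \<pi> s) (count_space UNIV)"
  by (simp add: measurable_cong_sets[OF sets_mdp_measure refl])

text \<open>The value is a sum of expectations, each at a single time, so the one-time marginals
  carry all the information needed. They follow the recursion of \<open>state_action_pmf\<close>
  because the kernel at time \<open>Suc n\<close> reads the past only through coordinate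
  \<open>n\<close>.\<close>

lemma distr_mdp_measure:
  fixes T :: "'s::finite \<Rightarrow> 'a::finite \<Rightarrow> 's pmf"
  shows "distr (mdp_measure T \<pi> s) (count_space UNIV) (\<lambda>\<omega>. \<omega> n) = measure_pmf (state_action_pmf T \<pi> s n)"
proof -
  let ?M = "\<lambda>_::nat. count_space (UNIV :: ('s \<times> 'a) set)"
  \<comment> \<open>\<open>?u\<close> is the empty trajectory: the only element of the product over
    the empty index set \<open>{0..<0}\<close>.\<close>
  let ?P = "mdp_kernel T \<pi> s" and ?u = "\<lambda>_::nat. undefined :: 's \<times> 'a"
  interpret Ionescu_Tulcea ?P ?M
    by (rule Ionescu_Tulcea_mdp_kernel)
  have u: "?u \<in> space (PiM {0..<0} ?M)"
    by simp
  have coord: "(\<lambda>\<omega>. \<omega> n) \<in> measurable (PiM {0..<Suc n} ?M) (count_space UNIV)" for n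
    by (intro measurable_component_singleton) auto
  have setsC: "sets (C 0 n ?u) = sets (PiM {0..<n} ?M)" for n
    using sets_C[OF u, of n] by simp
  have spaceC: "space (C 0 n ?u) = space (PiM {0..<n} ?M)" for n
    using space_C[OF u, of n] by simp
  have neC: "space (C 0 n ?u) \<noteq> {}" for n
    using prob_space.not_empty[OF prob_space_C[OF u, of n]] .
  have lim_C: "distr (mdp_measure T \<pi> s) (count_space UNIV) (\<lambda>\<omega>. \<omega> n) =
      distr (C 0 (Suc n) ?u) (count_space UNIV) (\<lambda>\<omega>. \<omega> n)" for n
  proof -
    \<comment> \<open>\<open>CI\<close> composes as many kernels as \<open>up_to\<close> says; this
      value brings in exactly \<open>C 0 (Suc n) ?u\<close>.\<close>
    have up: "up_to {0..<Suc n} = Suc n"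
      unfolding up_to_def by (rule Least_equality) (auto simp: not_less_eq_eq[symmetric])
    have "distr (mdp_measure T \<pi> s) (count_space UNIV) (\<lambda>\<omega>. \<omega> n) =
        distr (distr PF.lim (PiM {0..<Suc n} ?M) (\<lambda>\<omega>. restrict \<omega> {0..<Suc n})) (count_space UNIV) (\<lambda>\<omega>. \<omega> n)"
      unfolding mdp_measure_def
      by (subst distr_distr[OF coord])
         (auto simp: comp_def measurable_cong_sets[OF PF.sets_lim refl] intro!: measurable_restrict)
    also have "\<dots> = distr (CI {0..<Suc n}) (count_space UNIV) (\<lambda>\<omega>. \<omega> n)"
      by (subst distr_lim) auto
    also have "\<dots> = distr (C 0 (Suc n) ?u) (count_space UNIV) (\<lambda>\<omega>. \<omega> n)"
      unfolding CI_def up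
      by (subst distr_distr[OF coord])
         (auto simp: comp_def measurable_cong_sets[OF setsC refl] simp del: C.simps intro!: measurable_restrict)
    finally show ?thesis .
  qed
  \<comment> \<open>The last extension \<open>eP n\<close> draws coordinate \<open>n\<close> from
    \<open>?P n\<close> and appends it to the trajectory, so reading off coordinate \<open>n\<close>
    gives back \<open>?P n\<close>.\<close>
  have kernel: "distr (C 0 (Suc n) ?u) (count_space UNIV) (\<lambda>\<omega>. \<omega> n) = C 0 n ?u \<bind> ?P n" for n
  proof -
    have "distr (C 0 (Suc n) ?u) (count_space UNIV) (\<lambda>\<omega>. \<omega> n) =
        C 0 n ?u \<bind> (\<lambda>\<omega>. distr (eP n \<omega>) (count_space UNIV) (\<lambda>\<omega>. \<omega> n))"
      unfolding C.simps add_0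
      by (rule distr_bind[OF _ neC coord]) (simp add: measurable_cong_sets[OF setsC refl] measurable_eP)
    also have "\<dots> = C 0 n ?u \<bind> ?P n"
    proof (intro bind_cong refl)
      fix \<omega> assume "\<omega> \<in> space (C 0 n ?u)"
      then have \<omega>: "\<omega> \<in> space (PiM {0..<n} ?M)"
        by (simp add: spaceC)
      show "distr (eP n \<omega>) (count_space UNIV) (\<lambda>\<omega>. \<omega> n) = ?P n \<omega>"
        unfolding eP_def using \<omega>
        by (subst distr_distr[OF coord measurable_fun_upd[where J="{0..<n}"]])
           (auto simp: comp_def space_PiM mdp_kernel_def intro!: measurable_ident_sets distr_id2)
    qed
    finally show ?thesis .
  qed
  have "distr (C 0 (Suc n) ?u) (count_space UNIV) (\<lambda>\<omega>. \<omega> n) = measure_pmf (state_action_pmf T \<pi> s n)"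
  proof (induction n)
    case 0
    show ?case
      unfolding kernel unfolding C.simps
      by (subst bind_return[OF P]) (simp_all add: mdp_kernel_def bind_return_pmf)
  next
    case (Suc n)
    let ?step = "\<lambda>x. measure_pmf (bind_pmf (T (fst x) (snd x)) (\<lambda>s'. map_pmf (Pair s') (\<pi> s')))"
    \<comment> \<open>The integrand depends on the trajectory only through coordinate
      \<open>n\<close>, so the bind factors through the law of that coordinate, which the induction
      hypothesis identifies.\<close>
    have "distr (C 0 (Suc (Suc n)) ?u) (count_space UNIV) (\<lambda>\<omega>. \<omega> (Suc n)) =
        C 0 (Suc n) ?u \<bind> (\<lambda>\<omega>. ?step (\<omega> n))"
      unfolding kernel by (simp add: mdp_kernel_def[abs_def])
    also have "\<dots> = distr (C 0 (Suc n) ?u) (count_space UNIV) (\<lambda>\<omega>. \<omega> n) \<bind> ?step"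
      by (rule bind_distr[symmetric, where K="count_space UNIV"])
         (auto simp: measurable_cong_sets[OF setsC refl] coord measure_pmf_in_subprob_algebra neC simp del: C.simps)
    also have "\<dots> = measure_pmf (state_action_pmf T \<pi> s (Suc n))"
      unfolding Suc.IH by (simp add: measure_pmf_bind)
    finally show ?case .
  qed
  with lim_C show ?thesis
    by simp
qed


section \<open>Expectations on finite types and the value as a discounted series\<close>

lemma expectation_pmf_finite:
  fixes h :: "'b::finite \<Rightarrow> real"
  shows "measure_pmf.expectation p h = (\<Sum>x\<in>UNIV. pmf p x * h x)"
  by (subst integral_measure_pmf_real[of UNIV]) (simp_all add: mult.commute)

lemma expectation_bind_pmf_finite:
  fixes h :: "'c::finite \<Rightarrow> real" and p :: "'b::finite pmf"
  shows "measure_pmf.expectation (bind_pmf p k) h =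
    measure_pmf.expectation p (\<lambda>x. measure_pmf.expectation (k x) h)"
proof -
  have "(\<Sum>y\<in>UNIV. (\<Sum>x\<in>UNIV. pmf p x * pmf (k x) y) * h y) =
      (\<Sum>x\<in>UNIV. \<Sum>y\<in>UNIV. pmf p x * pmf (k x) y * h y)"
    by (simp add: sum_distrib_right) (rule sum.swap)
  then show ?thesis
    by (simp add: expectation_pmf_finite pmf_bind sum_distrib_left mult.assoc)
qed

lemma integrable_measure_pmf_finite_type [simp]:
  fixes h :: "'b::finite \<Rightarrow> real"
  shows "integrable (measure_pmf p) h"
  by (rule integrable_measure_pmf_finite) simp

definition entropy_reward ::
    "real \<Rightarrow> ('s \<Rightarrow> 'a \<Rightarrow> real) \<Rightarrow> ('s \<Rightarrow> 'a pmf) \<Rightarrow> 's \<times> 'a \<Rightarrow> real" where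
  "entropy_reward lam f \<pi> x = f (fst x) (snd x) - lam * ln (pmf (\<pi> (fst x)) (snd x))"

lemma abs_finite_bounded:
  fixes h :: "'b::finite \<Rightarrow> real"
  shows "\<bar>h x\<bar> \<le> (\<Sum>y\<in>UNIV. \<bar>h y\<bar>)"
  by (rule member_le_sum) auto

lemma abs_expectation_le:
  fixes h :: "'b::finite \<Rightarrow> real"
  shows "\<bar>measure_pmf.expectation p h\<bar> \<le> (\<Sum>y\<in>UNIV. \<bar>h y\<bar>)"
proof -
  have "\<bar>measure_pmf.expectation p h\<bar> \<le> measure_pmf.expectation p (\<lambda>x. \<bar>h x\<bar>)"
    by (rule integral_abs_bound)
  also have "\<dots> \<le> measure_pmf.expectation p (\<lambda>_. \<Sum>y\<in>UNIV. \<bar>h y\<bar>)"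
    by (intro integral_mono abs_finite_bounded) auto
  finally show ?thesis
    by simp
qed

lemma summable_discounted:
  fixes u :: "nat \<Rightarrow> real"
  assumes "0 \<le> \<gamma>" and "\<gamma> < 1" and "\<And>n. \<bar>u n\<bar> \<le> B"
  shows "summable (\<lambda>n. \<gamma> ^ n * u n)"
proof (rule summable_comparison_test')
  show "summable (\<lambda>n. B * \<gamma> ^ n)"
    using assms by (intro summable_mult summable_geometric) auto
  show "norm (\<gamma> ^ n * u n) \<le> B * \<gamma> ^ n" for n
    using assms mult_right_mono[OF assms(3)[of n], of "\<gamma> ^ n"]
    by (simp add: abs_mult mult.commute)
qed

text \<open>The one-step reward takes finitely many values, so the discounted series is dominated by
  a geometric one, and sum and integral may be exchanged.\<close>

lemma entropy_value_eq_suminf: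
  fixes T :: "'s::finite \<Rightarrow> 'a::finite \<Rightarrow> 's pmf"
  assumes "0 \<le> \<gamma>" and "\<gamma> < 1"
  shows "entropy_value T \<gamma> lam f \<pi> s =
    (\<Sum>t. \<gamma> ^ t * measure_pmf.expectation (state_action_pmf T \<pi> s t) (entropy_reward lam f \<pi>))"
proof -
  let ?M = "mdp_measure T \<pi> s" and ?r = "entropy_reward lam f \<pi>"
  let ?B = "\<Sum>x\<in>UNIV. \<bar>?r x\<bar>"
  interpret prob_space ?M
    by (rule prob_space_mdp_measure)
  have [measurable]: "(\<lambda>\<omega>. h (\<omega> t)) \<in> borel_measurable ?M" for h :: "'s \<times> 'a \<Rightarrow> real" and t
    by (rule measurable_compose[OF measurable_mdp_coordinate]) simp
  have int: "integrable ?M (\<lambda>\<omega>. h (\<omega> t))" for h :: "'s \<times> 'a \<Rightarrow> real" and t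
    by (rule integrable_const_bound[where B="\<Sum>x\<in>UNIV. \<bar>h x\<bar>"]) (auto simp: abs_finite_bounded)
  have expectation_coordinate:
    "(\<integral>\<omega>. h (\<omega> t) \<partial>?M) = measure_pmf.expectation (state_action_pmf T \<pi> s t) h"
    for h :: "'s \<times> 'a \<Rightarrow> real" and t
    by (simp add: distr_mdp_measure[symmetric] integral_distr)
  have "entropy_value T \<gamma> lam f \<pi> s = (\<integral>\<omega>. (\<Sum>t. \<gamma> ^ t * ?r (\<omega> t)) \<partial>?M)"
    by (simp add: entropy_value_def entropy_reward_def)
  also have "\<dots> = (\<Sum>t. \<integral>\<omega>. \<gamma> ^ t * ?r (\<omega> t) \<partial>?M)"
  proof (rule integral_suminf)
    show "integrable ?M (\<lambda>\<omega>. \<gamma> ^ t * ?r (\<omega> t))" for t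
      by (intro integrable_mult_right int)
    have "norm (\<gamma> ^ t * ?r (\<omega> t)) = \<gamma> ^ t * \<bar>?r (\<omega> t)\<bar>" for t \<omega>
      using assms by (simp add: abs_mult)
    then show "AE \<omega> in ?M. summable (\<lambda>t. norm (\<gamma> ^ t * ?r (\<omega> t)))"
      using assms by (auto intro!: AE_I2 summable_discounted[where B="?B"] simp: abs_finite_bounded)
    have "(\<integral>\<omega>. norm (\<gamma> ^ t * ?r (\<omega> t)) \<partial>?M) =
        \<gamma> ^ t * measure_pmf.expectation (state_action_pmf T \<pi> s t) (\<lambda>x. \<bar>?r x\<bar>)" for t
      using assms expectation_coordinate[of "\<lambda>x. \<bar>?r x\<bar>"] by (simp add: abs_mult)
    moreover have "\<bar>measure_pmf.expectation p (\<lambda>x. \<bar>?r x\<bar>)\<bar> \<le> ?B" for p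
      using abs_expectation_le[of p "\<lambda>x. \<bar>?r x\<bar>"] by simp
    ultimately show "summable (\<lambda>t. \<integral>\<omega>. norm (\<gamma> ^ t * ?r (\<omega> t)) \<partial>?M)"
      using assms by (simp add: summable_discounted[where B="?B"])
  qed
  also have "\<dots> = (\<Sum>t. \<gamma> ^ t * measure_pmf.expectation (state_action_pmf T \<pi> s t) ?r)"
    by (simp add: expectation_coordinate)
  finally show ?thesis .
qed

section \<open>Advantages and the performance difference formula\<close>

definition advantage ::
    "('s \<Rightarrow> 'a \<Rightarrow> 's pmf) \<Rightarrow> real \<Rightarrow> real \<Rightarrow> ('s \<Rightarrow> 'a \<Rightarrow> real) \<Rightarrow> ('s \<Rightarrow> 'a pmf) \<Rightarrow> ('s \<Rightarrow> real) \<Rightarrow>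
      's \<Rightarrow> real" where
  "advantage T \<gamma> lam f \<pi> W s = measure_pmf.expectation (\<pi> s)
     (\<lambda>a. entropy_reward lam f \<pi> (s, a) + \<gamma> * measure_pmf.expectation (T s a) W - W s)"

text \<open>Both clauses of the recursion end by drawing the action from \<pi> at the current state.
  This lets an expectation over pairs be taken over the action first, as \<open>advantage\<close>
  does.\<close>

lemma state_action_pmf_disintegration:
  "state_action_pmf T \<pi> s t =
    bind_pmf (map_pmf fst (state_action_pmf T \<pi> s t)) (\<lambda>x. map_pmf (Pair x) (\<pi> x))"
proof (cases t)
  case 0
  then show ?thesis
    by (simp add: map_pmf_comp bind_return_pmf)
next
  case (Suc n)
  then show ?thesis
    by (simp add: map_bind_pmf bind_assoc_pmf map_pmf_comp bind_return_pmf)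
qed

text \<open>No equation is assumed of \<open>W\<close>. A suitable choice of \<open>W\<close> later
  makes all terms vanish or have the same sign.\<close>

lemma performance_difference:
  fixes T :: "'s::finite \<Rightarrow> 'a::finite \<Rightarrow> 's pmf"
  assumes "0 \<le> \<gamma>" and "\<gamma> < 1"
  shows "(\<lambda>t. \<gamma> ^ t * measure_pmf.expectation (map_pmf fst (state_action_pmf T \<pi> s t))
      (advantage T \<gamma> lam f \<pi> W)) sums (entropy_value T \<gamma> lam f \<pi> s - W s)"
proof -
  let ?E = "\<lambda>t. measure_pmf.expectation (state_action_pmf T \<pi> s t)"
  let ?r = "entropy_reward lam f \<pi>"
  \<comment> \<open>The expectation of \<open>W\<close> at the state of time \<open>t\<close>. It is
    bounded in \<open>t\<close>, so its discounted values tend to 0 and their differences sum to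
    \<open>- W s\<close>.\<close>
  define u where "u t = ?E t (\<lambda>x. W (fst x))" for t
  have u0: "u 0 = W s"
    by (simp add: u_def)
  have uSuc: "u (Suc t) = ?E t (\<lambda>x. measure_pmf.expectation (T (fst x) (snd x)) W)" for t
    by (simp add: u_def expectation_bind_pmf_finite)
  have bound: "\<bar>u t\<bar> \<le> (\<Sum>x\<in>(UNIV :: ('s \<times> 'a) set). \<bar>W (fst x)\<bar>)" for t
    unfolding u_def by (rule abs_expectation_le)
  have "(\<lambda>t. \<gamma> ^ t * u t) \<longlonglongrightarrow> 0"
    using summable_discounted[OF assms bound] by (rule summable_LIMSEQ_zero)
  from telescope_sums[OF this] have tele: "(\<lambda>t. \<gamma> ^ Suc t * u (Suc t) - \<gamma> ^ t * u t) sums (- W s)"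
    by (simp add: u0)
  have "summable (\<lambda>t. \<gamma> ^ t * ?E t ?r)"
    by (rule summable_discounted[OF assms abs_expectation_le])
  then have "(\<lambda>t. \<gamma> ^ t * ?E t ?r) sums entropy_value T \<gamma> lam f \<pi> s"
    by (simp add: entropy_value_eq_suminf[OF assms] summable_sums)
  from sums_add[OF this tele]
  have "(\<lambda>t. \<gamma> ^ t * ?E t ?r + (\<gamma> ^ Suc t * u (Suc t) - \<gamma> ^ t * u t)) sums
      (entropy_value T \<gamma> lam f \<pi> s - W s)"
    by simp
  moreover have "\<gamma> ^ t * ?E t ?r + (\<gamma> ^ Suc t * u (Suc t) - \<gamma> ^ t * u t) =
      \<gamma> ^ t * measure_pmf.expectation (map_pmf fst (state_action_pmf T \<pi> s t)) (advantage T \<gamma> lam f \<pi> W)" for t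
  proof -
    have "\<gamma> ^ t * ?E t ?r + (\<gamma> ^ Suc t * u (Suc t) - \<gamma> ^ t * u t) =
        \<gamma> ^ t * ?E t (\<lambda>x. ?r x + \<gamma> * measure_pmf.expectation (T (fst x) (snd x)) W - W (fst x))"
      by (simp add: uSuc u_def[of t] algebra_simps)
    also have "?E t (\<lambda>x. ?r x + \<gamma> * measure_pmf.expectation (T (fst x) (snd x)) W - W (fst x)) =
        measure_pmf.expectation (map_pmf fst (state_action_pmf T \<pi> s t)) (advantage T \<gamma> lam f \<pi> W)"
      by (subst state_action_pmf_disintegration)
         (simp only: expectation_bind_pmf_finite integral_map_pmf advantage_def fst_conv snd_conv)
    finally show ?thesis .
  qed
  ultimately show ?thesis
    by simp
qed

section \<open>Gibbs inequality and the soft Bellman equation\<close>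

lemma gibbs_inequality:
  fixes p q :: "'b::finite pmf"
  assumes q: "\<And>x. pmf q x > 0"
  shows "measure_pmf.expectation p (\<lambda>x. ln (pmf q x) - ln (pmf p x)) \<le> 0"
    and "0 \<le> measure_pmf.expectation p (\<lambda>x. ln (pmf q x) - ln (pmf p x)) \<Longrightarrow> p = q"
proof -
  \<comment> \<open>Both masses are 1, so these terms sum to the relative entropy of
    \<open>p\<close> with respect to \<open>q\<close>; unlike its usual summands, each is
    nonnegative, by \<open>ln y \<le> y - 1\<close> with equality only at \<open>y = 1\<close>.
    Where \<open>p\<close> vanishes the logarithms are multiplied by 0, leaving
    \<open>pmf q x\<close>.\<close>
  define d where "d x = pmf q x - pmf p x - pmf p x * (ln (pmf q x) - ln (pmf p x))" for x
  have d_pos: "0 < d x" if "pmf p x \<noteq> pmf q x" for x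
  proof (cases "pmf p x = 0")
    case True
    with q show ?thesis
      by (simp add: d_def)
  next
    case False
    then have p: "pmf p x > 0"
      by (simp add: less_le)
    have "ln (pmf q x / pmf p x) \<noteq> pmf q x / pmf p x - 1"
      using ln_eq_minus_one[of "pmf q x / pmf p x"] that p q[of x] by auto
    moreover have "ln (pmf q x / pmf p x) \<le> pmf q x / pmf p x - 1"
      using p q[of x] by (intro ln_le_minus_one) auto
    ultimately have "ln (pmf q x / pmf p x) < pmf q x / pmf p x - 1"
      by simp
    then have "pmf p x * ln (pmf q x / pmf p x) < pmf p x * (pmf q x / pmf p x - 1)"
      using p by simp
    then show ?thesis
      using p q[of x] by (simp add: d_def ln_div algebra_simps)
  qed
  have d_nonneg: "0 \<le> d x" for x
    using d_pos[of x] by (cases "pmf p x = pmf q x") (auto simp: d_def)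
  have "(\<Sum>x\<in>UNIV. d x) =
      - measure_pmf.expectation p (\<lambda>x. ln (pmf q x) - ln (pmf p x))"
    by (simp add: d_def sum_subtractf expectation_pmf_finite sum_pmf_eq_1)
  moreover have "0 \<le> (\<Sum>x\<in>UNIV. d x)"
    by (intro sum_nonneg d_nonneg)
  ultimately show "measure_pmf.expectation p (\<lambda>x. ln (pmf q x) - ln (pmf p x)) \<le> 0"
    by simp
  assume "0 \<le> measure_pmf.expectation p (\<lambda>x. ln (pmf q x) - ln (pmf p x))"
  with \<open>(\<Sum>x\<in>UNIV. d x) = _\<close> \<open>0 \<le> (\<Sum>x\<in>UNIV. d x)\<close> have "(\<Sum>x\<in>UNIV. d x) = 0"
    by simp
  then have "d x = 0" for x
    using d_nonneg by (simp add: sum_nonneg_eq_0_iff)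
  then have "pmf p x = pmf q x" for x
    using d_pos[of x] by fastforce
  then show "p = q"
    by (rule pmf_eqI)
qed

text \<open>Demanding the equation for every action covers two facts at once: for \<pi> of full
  support and positive \<open>lam\<close> it says that \<pi> is \<open>exp ((Q - W) / lam)\<close>,
  and summing this over the actions gives the log-sum-exp equation for \<open>W\<close>.\<close>

definition soft_bellman_solution ::
    "('s \<Rightarrow> 'a \<Rightarrow> 's pmf) \<Rightarrow> real \<Rightarrow> real \<Rightarrow> ('s \<Rightarrow> 'a \<Rightarrow> real) \<Rightarrow> ('s \<Rightarrow> 'a pmf) \<Rightarrow> ('s \<Rightarrow> real) \<Rightarrow> bool"
  where
  "soft_bellman_solution T \<gamma> lam f \<pi> W \<longleftrightarrow>
     (\<forall>s a. W s = f s a - lam * ln (pmf (\<pi> s) a) + \<gamma> * measure_pmf.expectation (T s a) W)"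

lemma advantage_soft_bellman:
  assumes "soft_bellman_solution T \<gamma> lam f \<pi> W"
  shows "advantage T \<gamma> lam f \<pi>' W s =
    lam * measure_pmf.expectation (\<pi>' s) (\<lambda>a. ln (pmf (\<pi> s) a) - ln (pmf (\<pi>' s) a))"
proof -
  have "entropy_reward lam f \<pi>' (s, a) + \<gamma> * measure_pmf.expectation (T s a) W - W s =
      lam * (ln (pmf (\<pi> s) a) - ln (pmf (\<pi>' s) a))" for a
  proof -
    have "W s = f s a - lam * ln (pmf (\<pi> s) a) + \<gamma> * measure_pmf.expectation (T s a) W"
      using assms unfolding soft_bellman_solution_def by blast
    then show ?thesis
      by (simp add: entropy_reward_def algebra_simps)
  qed
  then show ?thesis
    by (simp add: advantage_def)
qed

text \<open>The advantages of \<pi> relative to \<open>W\<close> are zero, so the performance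
  difference is a sum of zeros.\<close>

lemma soft_bellman_value:
  fixes T :: "'s::finite \<Rightarrow> 'a::finite \<Rightarrow> 's pmf"
  assumes "0 \<le> \<gamma>" and "\<gamma> < 1" and "soft_bellman_solution T \<gamma> lam f \<pi> W"
  shows "entropy_value T \<gamma> lam f \<pi> s = W s"
proof -
  have "advantage T \<gamma> lam f \<pi> W = (\<lambda>_. 0)"
    by (simp add: fun_eq_iff advantage_soft_bellman[OF assms(3)])
  with performance_difference[OF assms(1,2), of T \<pi> s lam f W]
  have "(\<lambda>_. 0 :: real) sums (entropy_value T \<gamma> lam f \<pi> s - W s)"
    by simp
  from sums_unique2[OF this sums_zero] show ?thesis
    by simp
qed

text \<open>By Gibbs all terms of the performance difference are nonpositive. The term at time 0 is
  kept in the bound: it measures how far \<pi>' is from \<pi> in the state \<open>s\<close>, which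
  later yields uniqueness of the optimal policy.\<close>

lemma entropy_value_le_soft_bellman:
  fixes T :: "'s::finite \<Rightarrow> 'a::finite \<Rightarrow> 's pmf"
  assumes "0 \<le> \<gamma>" and "\<gamma> < 1" and "0 \<le> lam" and W: "soft_bellman_solution T \<gamma> lam f \<pi> W"
    and pos: "\<And>s a. pmf (\<pi> s) a > 0"
  shows "entropy_value T \<gamma> lam f \<pi>' s \<le> W s +
    lam * measure_pmf.expectation (\<pi>' s) (\<lambda>a. ln (pmf (\<pi> s) a) - ln (pmf (\<pi>' s) a))"
proof -
  let ?A = "advantage T \<gamma> lam f \<pi>' W"
  let ?x = "\<lambda>t. \<gamma> ^ t * measure_pmf.expectation (map_pmf fst (state_action_pmf T \<pi>' s t)) ?A"
  have A: "?A x \<le> 0" for x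
    using gibbs_inequality(1)[of "\<pi> x" "\<pi>' x"] pos assms(3)
    by (simp add: advantage_soft_bellman[OF W] mult_nonneg_nonpos)
  have sums: "?x sums (entropy_value T \<gamma> lam f \<pi>' s - W s)"
    by (rule performance_difference[OF assms(1,2)])
  have "?x t \<le> 0" for t
  proof -
    have "measure_pmf.expectation p ?A \<le> 0" for p
      using integral_mono[of "measure_pmf p" ?A "\<lambda>_. 0"] A by simp
    with assms(1) show ?thesis
      by (intro mult_nonneg_nonpos zero_le_power)
  qed
  then have "(\<lambda>t. - ?x t) sums (W s - entropy_value T \<gamma> lam f \<pi>' s)"
    and "\<And>t. 0 \<le> - ?x t"
    using sums_minus[OF sums] by simp_all
  from sum_le_suminf[OF sums_summable[OF this(1)], of "{0}"] this
  have "- ?x 0 \<le> W s - entropy_value T \<gamma> lam f \<pi>' s"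
    by (simp add: sums_unique[symmetric])
  moreover have "?x 0 = ?A s"
    by (simp add: map_pmf_comp)
  ultimately show ?thesis
    by (simp add: advantage_soft_bellman[OF W])
qed

section \<open>Existence of a soft optimal policy\<close>

definition soft_bellman ::
    "('s \<Rightarrow> 'a \<Rightarrow> 's pmf) \<Rightarrow> real \<Rightarrow> real \<Rightarrow> ('s \<Rightarrow> 'a::finite \<Rightarrow> real) \<Rightarrow> ('s \<Rightarrow> real) \<Rightarrow> 's \<Rightarrow> real" where
  "soft_bellman T \<gamma> lam f W s =
     lam * ln (\<Sum>a\<in>UNIV. exp ((f s a + \<gamma> * measure_pmf.expectation (T s a) W) / lam))"

lemma soft_bellman_mono:
  fixes T :: "'s::finite \<Rightarrow> 'a::finite \<Rightarrow> 's pmf"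
  assumes "0 \<le> \<gamma>" and "0 < lam" and "\<And>s. V s \<le> W s"
  shows "soft_bellman T \<gamma> lam f V s \<le> soft_bellman T \<gamma> lam f W s"
proof -
  have "measure_pmf.expectation p V \<le> measure_pmf.expectation p W" for p
    by (intro integral_mono assms) auto
  then have "(\<Sum>a\<in>UNIV. exp ((f s a + \<gamma> * measure_pmf.expectation (T s a) V) / lam)) \<le>
      (\<Sum>a\<in>UNIV. exp ((f s a + \<gamma> * measure_pmf.expectation (T s a) W) / lam))"
    using assms by (intro sum_mono) (auto simp: divide_right_mono mult_left_mono)
  moreover have "0 < (\<Sum>a\<in>(UNIV :: 'a set). exp (h a))" for h :: "'a \<Rightarrow> real"
    by (rule sum_pos) auto
  ultimately show ?thesis
    using assms by (simp add: soft_bellman_def)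
qed

text \<open>A constant added to all exponents leaves the log-sum-exp as a summand. This makes large
  constants supersolutions and their negatives subsolutions.\<close>

lemma soft_bellman_const:
  fixes T :: "'s::finite \<Rightarrow> 'a::finite \<Rightarrow> 's pmf"
  assumes "0 < lam"
  shows "soft_bellman T \<gamma> lam f (\<lambda>_. c) s = \<gamma> * c + soft_bellman T \<gamma> lam f (\<lambda>_. 0) s"
proof -
  have "0 < (\<Sum>a\<in>(UNIV :: 'a set). exp (f s a / lam))"
    by (rule sum_pos) auto
  moreover have "(\<Sum>a\<in>(UNIV :: 'a set). exp ((f s a + \<gamma> * c) / lam)) =
      exp (\<gamma> * c / lam) * (\<Sum>a\<in>UNIV. exp (f s a / lam))"
    by (simp add: sum_distrib_left exp_add add_divide_distrib mult.commute)
  ultimately show ?thesis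
    using assms by (simp add: soft_bellman_def ln_mult field_simps)
qed

lemma soft_bellman_fixed_point:
  fixes T :: "'s::finite \<Rightarrow> 'a::finite \<Rightarrow> 's pmf"
  assumes "0 \<le> \<gamma>" and "\<gamma> < 1" and "0 < lam"
  obtains W where "\<And>s. soft_bellman T \<gamma> lam f W s = W s"
proof -
  let ?B = "soft_bellman T \<gamma> lam f"
  \<comment> \<open>The constant \<open>c\<close> is a supersolution and \<open>- c\<close> a subsolution, so the iterates of \<open>c\<close>
    decrease and stay above \<open>- c\<close>.\<close>
  define c where "c = (\<Sum>s\<in>UNIV. \<bar>?B (\<lambda>_. 0) s\<bar>) / (1 - \<gamma>)"
  \<comment> \<open>Together with \<open>soft_bellman_const\<close> this bound yields both
    \<open>?B c \<le> c\<close> and \<open>- c \<le> ?B (- c)\<close>, constants being read as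
    functions.\<close>
  have c: "\<bar>?B (\<lambda>_. 0) s\<bar> \<le> (1 - \<gamma>) * c" for s
    using assms abs_finite_bounded[of "?B (\<lambda>_. 0)" s] by (simp add: c_def)
  define W where "W n = (?B ^^ n) (\<lambda>_. c)" for n
  have W0: "W 0 s = c" and WSuc: "W (Suc n) = ?B (W n)" for n s
    by (simp_all add: W_def)
  have "W (Suc n) s \<le> W n s" for n s
  proof (induction n arbitrary: s)
    case 0
    have "W 0 = (\<lambda>_. c)"
      by (simp add: W0 fun_eq_iff)
    then show ?case
      using c[of s] by (simp add: WSuc soft_bellman_const[OF assms(3), of T \<gamma> f c] algebra_simps)
  next
    case (Suc n)
    then show ?case
      unfolding WSuc[of "Suc n"] WSuc[of n] by (intro soft_bellman_mono assms) (simp add: WSuc)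
  qed
  then have dec: "decseq (\<lambda>n. W n s)" for s
    by (intro decseq_SucI)
  have lower: "- c \<le> W n s" for n s
  proof (induction n arbitrary: s)
    case 0
    have "0 \<le> c"
      using assms by (auto simp: c_def intro!: divide_nonneg_pos sum_nonneg)
    then show ?case
      by (simp add: W0)
  next
    case (Suc n)
    have "- c \<le> ?B (\<lambda>_. - c) s"
      using c[of s] by (simp add: soft_bellman_const[OF assms(3), of T \<gamma> f "- c"] algebra_simps)
    also have "\<dots> \<le> W (Suc n) s"
      unfolding WSuc by (intro soft_bellman_mono assms Suc.IH)
    finally show ?case .
  qed
  have "\<exists>L. (\<lambda>n. W n s) \<longlonglongrightarrow> L" for s
    using decseq_convergent[OF dec, of "- c"] lower by metis
  then obtain V where V: "\<And>s. (\<lambda>n. W n s) \<longlonglongrightarrow> V s"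
    by metis
  have "?B V s = V s" for s
  proof (rule LIMSEQ_unique)
    \<comment> \<open>The operator is built from finite sums, \<open>exp\<close> and
      \<open>ln\<close>; since the argument of \<open>ln\<close> stays away from 0 it is continuous,
      and the limit of the iterates is a fixed point.\<close>
    have "(\<Sum>a\<in>(UNIV :: 'a set). exp (h a)) \<noteq> 0" for h :: "'a \<Rightarrow> real"
      using sum_pos[of "UNIV :: 'a set" "\<lambda>a. exp (h a)"] by simp
    then show "(\<lambda>n. W (Suc n) s) \<longlonglongrightarrow> ?B V s"
      unfolding WSuc soft_bellman_def expectation_pmf_finite
      using assms by (intro tendsto_intros V) auto
    show "(\<lambda>n. W (Suc n) s) \<longlonglongrightarrow> V s"
      by (rule LIMSEQ_Suc[OF V])
  qed
  with that show ?thesis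
    by blast
qed

lemma soft_bellman_policy:
  fixes T :: "'s::finite \<Rightarrow> 'a::finite \<Rightarrow> 's pmf"
  assumes "0 \<le> \<gamma>" and "\<gamma> < 1" and "0 < lam"
  obtains \<pi> W where "\<And>s a. pmf (\<pi> s) a > 0" and "soft_bellman_solution T \<gamma> lam f \<pi> W"
proof -
  obtain W where W: "\<And>s. soft_bellman T \<gamma> lam f W s = W s"
    using soft_bellman_fixed_point[OF assms, where T=T and f=f] by blast
  define Q where "Q s a = f s a + \<gamma> * measure_pmf.expectation (T s a) W" for s a
  define \<pi> where "\<pi> s = embed_pmf (\<lambda>a. exp ((Q s a - W s) / lam))" for s
  have pmf: "pmf (\<pi> s) a = exp ((Q s a - W s) / lam)" for s a
  proof -
    have pos: "0 < (\<Sum>a\<in>UNIV. exp (Q s a / lam))"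
      by (rule sum_pos) auto
    \<comment> \<open>The fixed point equation identifies \<open>exp (W s / lam)\<close> with the
      normalizing sum of the Gibbs weights, so that \<open>embed_pmf\<close> receives a genuine
      distribution.\<close>
    have "W s / lam = ln (\<Sum>a\<in>UNIV. exp (Q s a / lam))"
      using W[of s] assms by (simp add: soft_bellman_def Q_def field_simps)
    with pos have "exp (W s / lam) = (\<Sum>a\<in>UNIV. exp (Q s a / lam))"
      by simp
    then have "(\<Sum>a\<in>UNIV. exp ((Q s a - W s) / lam)) = 1"
      using pos by (simp add: diff_divide_distrib exp_diff sum_divide_distrib[symmetric])
    then have "(\<integral>\<^sup>+a. ennreal (exp ((Q s a - W s) / lam)) \<partial>count_space UNIV) = 1"
      by (simp add: nn_integral_count_space_finite sum_ennreal)
    then show ?thesis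
      unfolding \<pi>_def by (subst pmf_embed_pmf) auto
  qed
  show ?thesis
  proof (rule that)
    show "pmf (\<pi> s) a > 0" for s a
      by (simp add: pmf)
    show "soft_bellman_solution T \<gamma> lam f \<pi> W"
      using assms by (simp add: soft_bellman_solution_def pmf Q_def)
  qed
qed

text \<open>For the direction from optimality, a soft Bellman pair \<pi>', \<open>W\<close> is
  constructed first. An optimal \<pi> attains at least the value \<open>W\<close>, which leaves no
  room for a positive relative entropy in any state, so \<pi> equals \<pi>'.\<close>

theorem entropy_optimal_iff_soft_bellman:
  fixes T :: "'s::finite \<Rightarrow> 'a::finite \<Rightarrow> 's pmf"
  assumes "0 \<le> \<gamma>" and "\<gamma> < 1" and "0 < lam" and pos: "\<And>s a. pmf (\<pi> s) a > 0"
  shows "entropy_optimal T \<gamma> lam f \<pi> \<longleftrightarrow> (\<exists>W. soft_bellman_solution T \<gamma> lam f \<pi> W)"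
proof
  assume "\<exists>W. soft_bellman_solution T \<gamma> lam f \<pi> W"
  then obtain W where W: "soft_bellman_solution T \<gamma> lam f \<pi> W" ..
  have "entropy_value T \<gamma> lam f \<pi>' s \<le> entropy_value T \<gamma> lam f \<pi> s" for \<pi>' s
  proof -
    have "lam * measure_pmf.expectation (\<pi>' s) (\<lambda>a. ln (pmf (\<pi> s) a) - ln (pmf (\<pi>' s) a)) \<le> 0"
      using assms(3) gibbs_inequality(1)[OF pos] by (intro mult_nonneg_nonpos) auto
    then show ?thesis
      using entropy_value_le_soft_bellman[OF assms(1,2) less_imp_le[OF assms(3)] W pos, of \<pi>' s]
        soft_bellman_value[OF assms(1,2) W, of s] by simp
  qed
  then show "entropy_optimal T \<gamma> lam f \<pi>"
    by (simp add: entropy_optimal_def)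
next
  assume opt: "entropy_optimal T \<gamma> lam f \<pi>"
  obtain \<pi>' W where pos': "\<And>s a. pmf (\<pi>' s) a > 0" and W: "soft_bellman_solution T \<gamma> lam f \<pi>' W"
    using soft_bellman_policy[OF assms(1-3), where T=T and f=f] by blast
  have "\<pi> s = \<pi>' s" for s
  proof (rule gibbs_inequality(2)[OF pos'])
    have "W s \<le> entropy_value T \<gamma> lam f \<pi> s"
      using opt soft_bellman_value[OF assms(1,2) W, of s] by (metis entropy_optimal_def)
    also have "\<dots> \<le> W s +
        lam * measure_pmf.expectation (\<pi> s) (\<lambda>a. ln (pmf (\<pi>' s) a) - ln (pmf (\<pi> s) a))"
      by (rule entropy_value_le_soft_bellman[OF assms(1,2) less_imp_le[OF assms(3)] W pos'])
    finally show "0 \<le> measure_pmf.expectation (\<pi> s) (\<lambda>a. ln (pmf (\<pi>' s) a) - ln (pmf (\<pi> s) a))"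
      using assms(3) by (simp add: zero_le_mult_iff)
  qed
  then have "\<pi> = \<pi>'" ..
  with W show "\<exists>W. soft_bellman_solution T \<gamma> lam f \<pi> W"
    by blast
qed

section \<open>The linear system and the rewards it describes\<close>

lemma trans_matrix_mult_nth:
  fixes T :: "'s::finite \<Rightarrow> 'a \<Rightarrow> 's pmf"
  shows "(trans_matrix T a *v x) $ s = measure_pmf.expectation (T s a) (($) x)"
  by (simp add: trans_matrix_def matrix_vector_mult_def expectation_pmf_finite)

lemma Delta_trans_mult_nth:
  fixes T :: "'s::finite \<Rightarrow> 'a \<Rightarrow> 's pmf"
  shows "(Delta_trans T a0 a *v x) $ s =
    measure_pmf.expectation (T s a) (($) x) - measure_pmf.expectation (T s a0) (($) x)"
  by (simp add: Delta_trans_def matrix_vector_mult_diff_rdistrib trans_matrix_mult_nth)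

text \<open>Maximum principle: where \<open>\<bar>h\<bar>\<close> attains its maximum
  \<open>m\<close>, the equation gives \<open>m \<le> \<gamma> * m\<close>, hence
  \<open>m \<le> 0\<close>.\<close>

lemma expectation_fixed_point_0:
  fixes k :: "'s::finite \<Rightarrow> 's pmf" and h :: "'s \<Rightarrow> real"
  assumes "0 \<le> \<gamma>" and "\<gamma> < 1" and h: "\<And>s. h s = \<gamma> * measure_pmf.expectation (k s) h"
  shows "h s = 0"
proof -
  define m where "m = Max (range (\<lambda>x. \<bar>h x\<bar>))"
  have le: "\<bar>h x\<bar> \<le> m" for x
    unfolding m_def by (rule Max_ge) auto
  have "m \<in> range (\<lambda>x. \<bar>h x\<bar>)"
    unfolding m_def by (rule Max_in) auto
  then obtain x where x: "m = \<bar>h x\<bar>"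
    by blast
  have "\<bar>measure_pmf.expectation (k x) h\<bar> \<le> measure_pmf.expectation (k x) (\<lambda>y. \<bar>h y\<bar>)"
    by (rule integral_abs_bound)
  also have "\<dots> \<le> measure_pmf.expectation (k x) (\<lambda>_. m)"
    by (intro integral_mono le) auto
  finally have "\<bar>measure_pmf.expectation (k x) h\<bar> \<le> m"
    by simp
  moreover have "m = \<gamma> * \<bar>measure_pmf.expectation (k x) h\<bar>"
    using h[of x] assms(1) unfolding x by (simp add: abs_mult)
  ultimately have "m \<le> \<gamma> * m"
    using assms(1) by (metis mult_left_mono)
  then have "(1 - \<gamma>) * m \<le> 0"
    by (simp add: algebra_simps)
  with assms(2) have "m \<le> 0"
    by (simp add: mult_le_0_iff)
  with le[of s] show ?thesis
    by linarith
qed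

text \<open>These vectors turn out to be the optimal value functions of the rewards that explain
  \<pi>.\<close>

definition irl_potentials ::
    "('s::finite \<Rightarrow> 'a \<Rightarrow> 's pmf) \<Rightarrow> real \<Rightarrow> real \<Rightarrow> ('s \<Rightarrow> 'a pmf) \<Rightarrow> 'a \<Rightarrow> (real ^ 's) set" where
  "irl_potentials T \<gamma> lam \<pi> a0 =
     {v. \<forall>a. lam *\<^sub>R Delta_log_policy \<pi> a0 a = \<gamma> *\<^sub>R (Delta_trans T a0 a *v v)}"

text \<open>The soft Bellman equation at the action \<open>a0\<close>, solved for the
  reward.\<close>

definition potential_reward ::
    "('s::finite \<Rightarrow> 'a \<Rightarrow> 's pmf) \<Rightarrow> real \<Rightarrow> real \<Rightarrow> ('s \<Rightarrow> 'a pmf) \<Rightarrow> 'a \<Rightarrow> real ^ 's \<Rightarrow> 's \<Rightarrow> real" where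
  "potential_reward T \<gamma> lam \<pi> a0 v s =
     v $ s + lam * ln (pmf (\<pi> s) a0) - \<gamma> * measure_pmf.expectation (T s a0) (($) v)"

lemma mem_irl_potentials_iff:
  "v \<in> irl_potentials T \<gamma> lam \<pi> a0 \<longleftrightarrow>
    (\<forall>s a. lam * (ln (pmf (\<pi> s) a) - ln (pmf (\<pi> s) a0)) =
      \<gamma> * (measure_pmf.expectation (T s a) (($) v) - measure_pmf.expectation (T s a0) (($) v)))"
  by (auto simp: irl_potentials_def vec_eq_iff Delta_trans_mult_nth Delta_log_policy_def log_policy_def)

text \<open>The soft Bellman equation at \<open>a0\<close> determines the reward from the value.
  Subtracting it from the equation at \<open>a\<close> cancels the value and the reward, which does
  not depend on the action; what remains is the linear system.\<close>

lemma irl_rewards_eq: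
  fixes T :: "'s::finite \<Rightarrow> 'a::finite \<Rightarrow> 's pmf"
  assumes "0 \<le> \<gamma>" and "\<gamma> < 1" and "0 < lam" and "\<And>s a. pmf (\<pi> s) a > 0"
  shows "irl_rewards T \<gamma> lam \<pi> = potential_reward T \<gamma> lam \<pi> a0 ` irl_potentials T \<gamma> lam \<pi> a0"
proof (intro equalityI subsetI)
  fix f assume "f \<in> irl_rewards T \<gamma> lam \<pi>"
  then obtain W where W:
    "\<And>s a. W s = f s - lam * ln (pmf (\<pi> s) a) + \<gamma> * measure_pmf.expectation (T s a) W"
    by (auto simp: irl_rewards_def entropy_optimal_iff_soft_bellman[OF assms] soft_bellman_solution_def)
  define v where "v = (\<chi> s. W s)"
  have v: "($) v = W"
    by (simp add: v_def fun_eq_iff)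
  have "v \<in> irl_potentials T \<gamma> lam \<pi> a0"
    unfolding mem_irl_potentials_iff v
  proof (intro allI)
    fix s a
    show "lam * (ln (pmf (\<pi> s) a) - ln (pmf (\<pi> s) a0)) =
        \<gamma> * (measure_pmf.expectation (T s a) W - measure_pmf.expectation (T s a0) W)"
      using W[of s a] W[of s a0] by (simp add: algebra_simps)
  qed
  moreover have "f s = potential_reward T \<gamma> lam \<pi> a0 v s" for s
    using W[of s a0] by (simp add: potential_reward_def v)
  ultimately show "f \<in> potential_reward T \<gamma> lam \<pi> a0 ` irl_potentials T \<gamma> lam \<pi> a0"
    by blast
next
  fix f assume "f \<in> potential_reward T \<gamma> lam \<pi> a0 ` irl_potentials T \<gamma> lam \<pi> a0"
  then obtain v where v: "v \<in> irl_potentials T \<gamma> lam \<pi> a0" and f: "f = potential_reward T \<gamma> lam \<pi> a0 v"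
    by blast
  have "soft_bellman_solution T \<gamma> lam (\<lambda>s a. f s) \<pi> (($) v)"
    unfolding soft_bellman_solution_def
  proof (intro allI)
    fix s a
    show "v $ s = f s - lam * ln (pmf (\<pi> s) a) + \<gamma> * measure_pmf.expectation (T s a) (($) v)"
      using v[unfolded mem_irl_potentials_iff, rule_format, of s a]
      by (simp add: f potential_reward_def algebra_simps)
  qed
  then show "f \<in> irl_rewards T \<gamma> lam \<pi>"
    by (auto simp: irl_rewards_def entropy_optimal_iff_soft_bellman[OF assms])
qed

lemma vec_nth_scaleR_1: "($) (c *\<^sub>R 1) = (\<lambda>_. c)"
  by (simp add: fun_eq_iff)

text \<open>The rows of both transition matrices sum to 1, so the two matrices agree on multiples of
  the all-one vector \<open>1\<close>.\<close>

lemma const_in_Delta_kernel: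
  fixes T :: "'s::finite \<Rightarrow> 'a \<Rightarrow> 's pmf"
  shows "c *\<^sub>R 1 \<in> Delta_kernel T a0 a"
  by (simp add: Delta_kernel_def vec_eq_iff Delta_trans_mult_nth vec_nth_scaleR_1)

text \<open>The factor \<gamma> has to be cancelled: for \<gamma> equal to 0 the system puts no
  constraint on the vector.\<close>

lemma irl_potentials_diff_in_Delta_kernel:
  assumes "\<gamma> \<noteq> 0" and "v \<in> irl_potentials T \<gamma> lam \<pi> a0" and "w \<in> irl_potentials T \<gamma> lam \<pi> a0"
  shows "w - v \<in> Delta_kernel T a0 a"
proof -
  have "\<gamma> *\<^sub>R (Delta_trans T a0 a *v w) = \<gamma> *\<^sub>R (Delta_trans T a0 a *v v)"
    using assms(2,3) by (metis (mono_tags, lifting) irl_potentials_def mem_Collect_eq)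
  with assms(1) show ?thesis
    by (simp add: Delta_kernel_def matrix_vector_mult_diff_distrib)
qed

lemma irl_potentials_add:
  assumes "v \<in> irl_potentials T \<gamma> lam \<pi> a0" and "\<And>a. x \<in> Delta_kernel T a0 a"
  shows "v + x \<in> irl_potentials T \<gamma> lam \<pi> a0"
  using assms by (simp add: irl_potentials_def Delta_kernel_def matrix_vector_right_distrib)

lemma potential_reward_add:
  fixes T :: "'s::finite \<Rightarrow> 'a \<Rightarrow> 's pmf"
  shows "potential_reward T \<gamma> lam \<pi> a0 (v + x) s = potential_reward T \<gamma> lam \<pi> a0 v s +
    (x $ s - \<gamma> * measure_pmf.expectation (T s a0) (($) x))"
  by (simp add: potential_reward_def expectation_pmf_finite distrib_left sum.distrib)

text \<open>The potential \<open>v\<close> is a base point for perturbations by kernel vectors.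
  Without any potential no reward would explain \<pi>, and identifiability would hold
  vacuously.\<close>

theorem irl_identifiable_iff:
  fixes T :: "'s::finite \<Rightarrow> 'a::finite \<Rightarrow> 's pmf"
  assumes "0 < \<gamma>" and "\<gamma> < 1" and "0 < lam" and "\<And>s a. pmf (\<pi> s) a > 0"
    and v: "v \<in> irl_potentials T \<gamma> lam \<pi> a0"
  shows "irl_identifiable T \<gamma> lam \<pi> \<longleftrightarrow> (\<Inter>a. Delta_kernel T a0 a) \<subseteq> {c *\<^sub>R 1 | c. True}"
proof -
  note rewards = irl_rewards_eq[OF less_imp_le[OF assms(1)] assms(2-4), where T=T and ?a0.0=a0]
  let ?V = "irl_potentials T \<gamma> lam \<pi> a0" and ?f = "potential_reward T \<gamma> lam \<pi> a0"
  show ?thesis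
  proof
    assume ident: "irl_identifiable T \<gamma> lam \<pi>"
    show "(\<Inter>a. Delta_kernel T a0 a) \<subseteq> {c *\<^sub>R 1 | c. True}"
    proof
      fix x assume "x \<in> (\<Inter>a. Delta_kernel T a0 a)"
      then have "v + x \<in> ?V"
        by (intro irl_potentials_add v) auto
      with ident v have "\<exists>c. \<forall>s. ?f (v + x) s = ?f v s + c"
        by (simp add: irl_identifiable_def rewards)
      then obtain c where "\<And>s. ?f (v + x) s = ?f v s + c"
        by blast
      then have c: "x $ s - \<gamma> * measure_pmf.expectation (T s a0) (($) x) = c" for s
        by (simp add: potential_reward_add)
      \<comment> \<open>The constant vector \<open>d\<close> has the same image \<open>c\<close> as
        \<open>x\<close> under the map from potential shifts to reward shifts. The difference
        \<open>x - d\<close> is therefore mapped to 0, and the maximum principle applies.\<close>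
      define d where "d = c / (1 - \<gamma>)"
      have "(1 - \<gamma>) * d = c"
        using assms(2) by (simp add: d_def)
      then have d: "c = d - \<gamma> * d"
        by (simp add: algebra_simps)
      have "x $ s - d = 0" for s
      proof (rule expectation_fixed_point_0[OF less_imp_le[OF assms(1)] assms(2)])
        show "x $ s - d = \<gamma> * measure_pmf.expectation (T s a0) (\<lambda>s. x $ s - d)" for s
          using c[of s] by (simp add: d algebra_simps)
      qed
      then have "x = d *\<^sub>R 1"
        by (simp add: vec_eq_iff)
      then show "x \<in> {c *\<^sub>R 1 | c. True}"
        by blast
    qed
  next
    assume const: "(\<Inter>a. Delta_kernel T a0 a) \<subseteq> {c *\<^sub>R 1 | c. True}"
    have "\<exists>c. \<forall>s. ?f w s = ?f u s + c" if "u \<in> ?V" "w \<in> ?V" for u w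
    proof -
      have "w - u \<in> (\<Inter>a. Delta_kernel T a0 a)"
        using irl_potentials_diff_in_Delta_kernel[OF _ that] assms(1) by auto
      with const obtain c where "w - u = c *\<^sub>R 1"
        by blast
      then have w: "w = u + c *\<^sub>R 1"
        by (simp add: algebra_simps)
      have "?f w s = ?f u s + (c - \<gamma> * c)" for s
        by (simp add: w potential_reward_add vec_nth_scaleR_1)
      then show ?thesis
        by blast
    qed
    then show "irl_identifiable T \<gamma> lam \<pi>"
      by (auto simp: irl_identifiable_def rewards)
  qed
qed

theorem corollary3:
  fixes T :: "'s::finite \<Rightarrow> 'a::finite \<Rightarrow> 's pmf"
    and \<pi> :: "'s \<Rightarrow> 'a pmf"
    and \<gamma> lam :: real
    and a0 :: 'a
  assumes "CARD('s) \<ge> 2" and "CARD('a) \<ge> 2"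
    and "0 < \<gamma>" and "\<gamma> < 1" and "lam > 0"
    and "\<And>s a. pmf (\<pi> s) a > 0"
    and "\<exists>v :: real ^ 's. \<forall>a. lam *\<^sub>R Delta_log_policy \<pi> a0 a = \<gamma> *\<^sub>R (Delta_trans T a0 a *v v)"
  shows "(irl_identifiable T \<gamma> lam \<pi> \<longleftrightarrow>
            {c *\<^sub>R (1 :: real ^ 's) | c. True} = (\<Inter>a \<in> UNIV - {a0}. Delta_kernel T a0 a) \<and>
            (\<Inter>a \<in> UNIV - {a0}. Delta_kernel T a0 a) = (\<Inter>a. Delta_kernel T a0 a)) \<and>
         (\<forall>a \<in> UNIV - {a0}. {c *\<^sub>R (1 :: real ^ 's) | c. True} \<subseteq> Delta_kernel T a0 a) \<and>
         Delta_trans T a0 a0 = 0 \<and> Delta_kernel T a0 a0 = UNIV"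
proof -
  let ?C = "{c *\<^sub>R (1 :: real ^ 's) | c. True}"
  have zero: "Delta_trans T a0 a0 = 0"
    by (simp add: Delta_trans_def)
  then have a0: "Delta_kernel T a0 a0 = UNIV"
    by (simp add: Delta_kernel_def)
  then have Inter: "(\<Inter>a \<in> UNIV - {a0}. Delta_kernel T a0 a) = (\<Inter>a. Delta_kernel T a0 a)"
    by auto
  have const: "?C \<subseteq> Delta_kernel T a0 a" for a
    by (auto simp: const_in_Delta_kernel)
  obtain v where "v \<in> irl_potentials T \<gamma> lam \<pi> a0"
    using assms(7) by (auto simp: irl_potentials_def)
  then have "irl_identifiable T \<gamma> lam \<pi> \<longleftrightarrow> (\<Inter>a. Delta_kernel T a0 a) \<subseteq> ?C"
    by (rule irl_identifiable_iff[OF assms(3-6)])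
  \<comment> \<open>Constants lie in every kernel, so containment in the constants is already
    equality.\<close>
  also have "\<dots> \<longleftrightarrow> ?C = (\<Inter>a. Delta_kernel T a0 a)"
    using const by blast
  finally show ?thesis
    using zero a0 Inter const by simp
qed

end
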